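(* Let $(\mathcal{G},c)$ be a coloured DAG with compatible colouring $c$. The set $A(\mathcal{G},c)$ is a group (under matrix multiplication) if and only if (a) $\mathcal{G}$ is transitive; and (b) if $c(ij)=c(kl)$ for edges $j\to i$, $l\to k$ in $\mathcal{G}$, then $\mathcal{G}_{b(ij)}\simeq\mathcal{G}_{b(kl)}$.
   Context: $\mathcal{G}=(I,E)$ is a directed acyclic graph (DAG) with vertex set $I=[m]=\{1,\dots,m\}$ and edge set $E$ (no loops, no multiple edges); $j\to i$ denotes an edge from $j$ to $i$. Vertices are ordered so that $j\to i$ implies $j>i$. $\mathcal{G}$ is transitive if whenever $k\to j$ and $j\to i$ are in $\mathcal{G}$ then so is $k\to i$. A coloured DAG $(\mathcal{G},c)$ is a DAG with a map $c: I\cup E\to \mathcal{C}$ to a set of colours; $c(i)$ (also written $c(ii)$) is the colour of vertex $i$ and $c(ij)$ is the colour of the edge $j\to i$. The colouring $c$ is compatible if (i) vertex colours and edge colours are disjoint, and (ii) whenever edges $j\to i$ and $l\to k$ satisfy $c(ij)=c(kl)$, then $c(i)=c(k)$. $A(\mathcal{G},c)$ is the set of real invertible $m\times m$ matrices $a$ with $a_{ij}=0$ for $i\ne j$ with $j\not\to i$ in $\mathcal{G}$, and $a_{ij}=a_{kl}$ whenever $c(ij)=c(kl)$ (for vertices and edges). For $i,j\in I$, $b(ij)=\{k\in I\mid j\to k \text{ and } k\to i \text{ in } \mathcal{G}\}$, and $\mathcal{G}_{b(ij)}$ is the coloured graph on vertex set $\{i\}\cup\{j\}\cup b(ij)$ with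 edges $k\to i$ and $j\to k$ for each $k\in b(ij)$, and vertex and edge colours inherited from $c$. The notation $\simeq$ means isomorphism of coloured directed graphs, i.e. equality (including vertex and edge colours) up to relabelling vertices. *)

theory Defs
  imports "HOL-Analysis.Analysis" "HOL-Algebra.Group"
begin

text \<open>
  The vertex set \<open>I = {1, ..., m}\<close> is the universe of a finite linearly ordered type \<open>'v\<close>, which also
  indexes the rows and columns of the matrices. An edge \<open>j \<rightarrow> i\<close> is the pair \<open>(j, i)\<close>, whereas matrix
  entries and colours have their indices in the order \<open>i, j\<close>. A colouring of \<open>I \<union> E\<close> is a single function
  \<open>c\<close>: the colour of the vertex \<open>i\<close> is \<open>c i i\<close>, and the colour of the edge \<open>j \<rightarrow> i\<close> is \<open>c i j\<close>. There are
  no loops, so the two do not clash; the values of \<open>c\<close> at other pairs are never used.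
\<close>

definition ordered_dag :: "('v::{finite,linorder} \<times> 'v) set \<Rightarrow> bool" where
  "ordered_dag E \<longleftrightarrow> acyclic E \<and> (\<forall>i j. (j, i) \<in> E \<longrightarrow> j > i)"

definition compatible :: "('v \<times> 'v) set \<Rightarrow> ('v \<Rightarrow> 'v \<Rightarrow> 'c) \<Rightarrow> bool" where
  "compatible E c \<longleftrightarrow>
     {c i i | i. True} \<inter> {c i j | i j. (j, i) \<in> E} = {} \<and>
     (\<forall>i j k l. (j, i) \<in> E \<longrightarrow> (l, k) \<in> E \<longrightarrow> c i j = c k l \<longrightarrow> c i i = c k k)"

definition coloured_matrices ::
    "('v::finite \<times> 'v) set \<Rightarrow> ('v \<Rightarrow> 'v \<Rightarrow> 'c) \<Rightarrow> (real ^ 'v ^ 'v) set" where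
  "coloured_matrices E c =
     {a. invertible a \<and>
         (\<forall>i j. i \<noteq> j \<longrightarrow> (j, i) \<notin> E \<longrightarrow> a $ i $ j = 0) \<and>
         (\<forall>i j k l. i = j \<or> (j, i) \<in> E \<longrightarrow> k = l \<or> (l, k) \<in> E \<longrightarrow> c i j = c k l
            \<longrightarrow> a $ i $ j = a $ k $ l)}"

definition coloured_matrix_group ::
    "('v::finite \<times> 'v) set \<Rightarrow> ('v \<Rightarrow> 'v \<Rightarrow> 'c) \<Rightarrow> (real ^ 'v ^ 'v) monoid" where
  "coloured_matrix_group E c =
     \<lparr>carrier = coloured_matrices E c, monoid.mult = (**), one = mat 1\<rparr>"

record ('v, 'c) coloured_graph =
  vertices :: "'v set"
  edges :: "('v \<times> 'v) set"
  colour :: "'v \<Rightarrow> 'v \<Rightarrow> 'c"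

definition coloured_graph_iso ::
    "('v, 'c) coloured_graph \<Rightarrow> ('w, 'c) coloured_graph \<Rightarrow> bool" where
  "coloured_graph_iso G H \<longleftrightarrow>
     (\<exists>f. bij_betw f (vertices G) (vertices H) \<and>
        (\<forall>x\<in>vertices G. \<forall>y\<in>vertices G. (x, y) \<in> edges G \<longleftrightarrow> (f x, f y) \<in> edges H) \<and>
        (\<forall>x\<in>vertices G. colour G x x = colour H (f x) (f x)) \<and>
        (\<forall>x y. (x, y) \<in> edges G \<longrightarrow> colour G y x = colour H (f y) (f x)))"

definition between :: "('v \<times> 'v) set \<Rightarrow> 'v \<Rightarrow> 'v \<Rightarrow> 'v set" where
  "between E i j = {k. (j, k) \<in> E \<and> (k, i) \<in> E}"

text \<open>This is not the induced subgraph: it has neither the edge \<open>j \<rightarrow> i\<close> nor edges inside \<open>between E i j\<close>.\<close>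

definition between_graph ::
    "('v \<times> 'v) set \<Rightarrow> ('v \<Rightarrow> 'v \<Rightarrow> 'c) \<Rightarrow> 'v \<Rightarrow> 'v \<Rightarrow> ('v, 'c) coloured_graph" where
  "between_graph E c i j =
     \<lparr>vertices = {i} \<union> {j} \<union> between E i j,
      edges = {(k, i) | k. k \<in> between E i j} \<union> {(j, k) | k. k \<in> between E i j},
      colour = c\<rparr>"

end

theory Submission imports Defs begin

text \<open>
  Dropping invertibility from \<open>A(\<G>, c)\<close> leaves a linear space \<open>V\<close> of matrices that contains the
  identity. For matrices supported on the diagonal and the edges, the product has diagonal entries
  \<open>a\<^sub>i\<^sub>i b\<^sub>i\<^sub>i\<close> and, at an edge \<open>j \<rightarrow> i\<close>, the entry
  \<open>a\<^sub>i\<^sub>i b\<^sub>i\<^sub>j + a\<^sub>i\<^sub>j b\<^sub>j\<^sub>j + (\<Sum>p\<in>b(ij). a\<^sub>i\<^sub>p b\<^sub>p\<^sub>j)\<close>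
  (lemma \<open>product_at_edge\<close>).

  If (a) and (b) hold, transitivity keeps the support of a product inside the diagonal and the
  edges. An isomorphism \<open>\<G>\<^bsub>b(ij)\<^esub> \<simeq> \<G>\<^bsub>b(kl)\<^esub>\<close> restricts to a bijection
  \<open>b(ij) \<rightarrow> b(kl)\<close> that preserves the colours of both edges at each intermediate vertex, so the two
  sums agree: \<open>V\<close> is closed under products. For invertible \<open>a \<in> V\<close>, left multiplication by \<open>a\<close> is
  an injective linear endomorphism of the finite-dimensional space \<open>V\<close>, hence surjective, and the
  preimage of the identity is an inverse of \<open>a\<close> in \<open>V\<close>.

  Conversely, suppose that \<open>A(\<G>, c)\<close> is closed under products. The square of the matrix with ones
  on the diagonal and at all edges detects every path of length two, so \<open>\<G>\<close> is transitive. If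
  \<open>c(ij) = c(kl)\<close>, multiplying by a diagonal matrix shows \<open>c(j) = c(l)\<close>. For the product of the
  matrices with ones on the diagonal and at the edges of colour \<open>\<alpha>\<close>, respectively \<open>\<beta>\<close>, the entry at
  \<open>j \<rightarrow> i\<close> is a number depending only on \<open>c(ij)\<close> plus the number of vertices \<open>p \<in> b(ij)\<close> with
  \<open>c(ip) = \<alpha>\<close> and \<open>c(pj) = \<beta>\<close>. These counts agree for \<open>b(ij)\<close> and
  \<open>b(kl)\<close>, which yields a bijection \<open>b(ij) \<rightarrow> b(kl)\<close> preserving edge colours; it preserves vertex
  colours because the colour of the edge \<open>j \<rightarrow> p\<close> determines that of \<open>p\<close>.
\<close>

section \<open>The linear space of coloured matrices\<close>

text \<open>The matrices with the zero and equality pattern of \<open>A(\<G>, c)\<close>, invertible or not.\<close>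

definition coloured_space ::
    "('v::finite \<times> 'v) set \<Rightarrow> ('v \<Rightarrow> 'v \<Rightarrow> 'c) \<Rightarrow> (real ^ 'v ^ 'v) set" where
  "coloured_space E c =
     {a. (\<forall>i j. i \<noteq> j \<longrightarrow> (j, i) \<notin> E \<longrightarrow> a $ i $ j = 0) \<and>
         (\<forall>i j k l. i = j \<or> (j, i) \<in> E \<longrightarrow> k = l \<or> (l, k) \<in> E \<longrightarrow> c i j = c k l
            \<longrightarrow> a $ i $ j = a $ k $ l)}"

lemma coloured_matrices_eq:
  "coloured_matrices E c = {a \<in> coloured_space E c. invertible a}"
  by (auto simp: coloured_matrices_def coloured_space_def)

lemma coloured_space_zero:
  "a \<in> coloured_space E c \<Longrightarrow> i \<noteq> j \<Longrightarrow> (j, i) \<notin> E \<Longrightarrow> a $ i $ j = 0"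
  by (simp add: coloured_space_def)

lemma coloured_space_eq:
  assumes "a \<in> coloured_space E c" "i = j \<or> (j, i) \<in> E" "k = l \<or> (l, k) \<in> E" "c i j = c k l"
  shows "a $ i $ j = a $ k $ l"
proof -
  have "\<forall>i j k l. i = j \<or> (j, i) \<in> E \<longrightarrow> k = l \<or> (l, k) \<in> E \<longrightarrow> c i j = c k l
      \<longrightarrow> a $ i $ j = a $ k $ l"
    using assms(1) unfolding coloured_space_def mem_Collect_eq by (rule conjunct2)
  from this[rule_format, OF assms(2-4)] show ?thesis .
qed

lemma coloured_space_vertex_eq:
  "a \<in> coloured_space E c \<Longrightarrow> c i i = c k k \<Longrightarrow> a $ i $ i = a $ k $ k"
  by (rule coloured_space_eq[of a E c]) auto

lemma coloured_space_edge_eq: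
  "a \<in> coloured_space E c \<Longrightarrow> (j, i) \<in> E \<Longrightarrow> (l, k) \<in> E \<Longrightarrow> c i j = c k l \<Longrightarrow> a $ i $ j = a $ k $ l"
  by (rule coloured_space_eq[of a E c]) auto

lemma subspace_coloured_space: "subspace (coloured_space E c)"
proof (rule subspaceI)
  show "0 \<in> coloured_space E c" by (simp add: coloured_space_def)
next
  fix x y assume x: "x \<in> coloured_space E c" and y: "y \<in> coloured_space E c"
  show "x + y \<in> coloured_space E c"
    unfolding coloured_space_def
  proof (intro CollectI conjI allI impI)
    fix i j k l
    assume "i = j \<or> (j, i) \<in> E" "k = l \<or> (l, k) \<in> E" "c i j = c k l"
    then have "x $ i $ j = x $ k $ l" "y $ i $ j = y $ k $ l"
      using coloured_space_eq[OF x] coloured_space_eq[OF y] by blast+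
    then show "(x + y) $ i $ j = (x + y) $ k $ l" by simp
  qed (simp add: coloured_space_zero[OF x] coloured_space_zero[OF y])
next
  fix r x assume x: "x \<in> coloured_space E c"
  show "r *\<^sub>R x \<in> coloured_space E c"
    unfolding coloured_space_def
  proof (intro CollectI conjI allI impI)
    fix i j k l
    assume "i = j \<or> (j, i) \<in> E" "k = l \<or> (l, k) \<in> E" "c i j = c k l"
    then have "x $ i $ j = x $ k $ l" by (rule coloured_space_eq[OF x])
    then show "(r *\<^sub>R x) $ i $ j = (r *\<^sub>R x) $ k $ l" by simp
  qed (simp add: coloured_space_zero[OF x])
qed

lemma compatible_vertex_edge: "compatible E c \<Longrightarrow> (l, k) \<in> E \<Longrightarrow> c i i \<noteq> c k l"
  unfolding compatible_def by blast

lemma compatible_target: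
  "compatible E c \<Longrightarrow> (j, i) \<in> E \<Longrightarrow> (l, k) \<in> E \<Longrightarrow> c i j = c k l \<Longrightarrow> c i i = c k k"
  unfolding compatible_def by blast

text \<open>Vertices and edges have different colours, so the equality pattern only needs to be checked
  on pairs of vertices and on pairs of edges.\<close>

lemma coloured_spaceI:
  assumes "compatible E c"
    and "\<And>i j. i \<noteq> j \<Longrightarrow> (j, i) \<notin> E \<Longrightarrow> a $ i $ j = 0"
    and "\<And>i k. c i i = c k k \<Longrightarrow> a $ i $ i = a $ k $ k"
    and "\<And>i j k l. (j, i) \<in> E \<Longrightarrow> (l, k) \<in> E \<Longrightarrow> c i j = c k l \<Longrightarrow> a $ i $ j = a $ k $ l"
  shows "a \<in> coloured_space E c"
  unfolding coloured_space_def
proof (intro CollectI conjI allI impI)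
  fix i j k l
  assume "i = j \<or> (j, i) \<in> E" "k = l \<or> (l, k) \<in> E" "c i j = c k l"
  then show "a $ i $ j = a $ k $ l"
    using assms(3,4) compatible_vertex_edge[OF assms(1)] by metis
qed (use assms(2) in auto)

lemma ordered_dag_less: "ordered_dag E \<Longrightarrow> (j, i) \<in> E \<Longrightarrow> i < j"
  unfolding ordered_dag_def by blast

text \<open>Such a matrix is triangular: in a nonzero kernel vector, the row of the last nonzero coordinate
  gives a contradiction.\<close>

lemma invertible_if_diagonal_nonzero:
  fixes E :: "('v::{finite,linorder} \<times> 'v) set"
  assumes E: "ordered_dag E" and a: "a \<in> coloured_space E c" and d: "\<And>i. a $ i $ i \<noteq> 0"
  shows "invertible a"
proof -
  have "x = 0" if x: "a *v x = 0" for x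
  proof (rule ccontr)
    assume "x \<noteq> 0"
    then have ne: "{j. x $ j \<noteq> 0} \<noteq> {}" by (auto simp: vec_eq_iff)
    define j where "j = Max {j. x $ j \<noteq> 0}"
    have j: "x $ j \<noteq> 0" using Max_in[OF _ ne] unfolding j_def by simp
    have above: "x $ k = 0" if "j < k" for k
      using that Max_ge[of "{j. x $ j \<noteq> 0}" k] unfolding j_def by fastforce
    have z: "a $ j $ k * x $ k = 0" if "k \<noteq> j" for k
    proof (cases "(k, j) \<in> E")
      case True
      then show ?thesis using ordered_dag_less[OF E] above by simp
    next
      case False
      then show ?thesis using that coloured_space_zero[OF a] by simp
    qed
    have "(a *v x) $ j = (\<Sum>k\<in>UNIV. a $ j $ k * x $ k)" by (simp add: matrix_vector_mult_def)
    also have "\<dots> = (\<Sum>k\<in>{j}. a $ j $ k * x $ k)"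
      by (rule sum.mono_neutral_right) (use z in auto)
    finally show False using x d j by simp
  qed
  then show ?thesis
    by (simp add: invertible_left_inverse matrix_left_invertible_ker)
qed

section \<open>Entries of products\<close>

lemma product_zero:
  assumes a: "a \<in> coloured_space E c" and b: "b \<in> coloured_space E c"
    and "trans E" "i \<noteq> j" "(j, i) \<notin> E"
  shows "(a ** b) $ i $ j = 0"
proof -
  have "a $ i $ k * b $ k $ j = 0" for k
    using assms(3-5) coloured_space_zero[OF a, of i k] coloured_space_zero[OF b, of k j]
    by (metis mult_eq_0_iff transD)
  then have "(\<Sum>k\<in>UNIV. a $ i $ k * b $ k $ j) = 0" by (intro sum.neutral) blast
  then show ?thesis by (simp add: matrix_matrix_mult_def)
qed

lemma product_at_vertex:
  assumes E: "ordered_dag E" and a: "a \<in> coloured_space E c" and b: "b \<in> coloured_space E c"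
  shows "(a ** b) $ i $ i = a $ i $ i * b $ i $ i"
proof -
  have z: "a $ i $ k * b $ k $ i = 0" if "k \<noteq> i" for k
    using that coloured_space_zero[OF a, of i k] coloured_space_zero[OF b, of k i]
      ordered_dag_less[OF E] by (metis mult_eq_0_iff less_asym)
  have "(a ** b) $ i $ i = (\<Sum>k\<in>UNIV. a $ i $ k * b $ k $ i)"
    by (simp add: matrix_matrix_mult_def)
  also have "\<dots> = (\<Sum>k\<in>{i}. a $ i $ k * b $ k $ i)"
    by (rule sum.mono_neutral_right) (use z in auto)
  finally show ?thesis by simp
qed

lemma product_at_edge:
  assumes E: "ordered_dag E" and a: "a \<in> coloured_space E c" and b: "b \<in> coloured_space E c"
    and ne: "i \<noteq> j"
  shows "(a ** b) $ i $ j = a $ i $ i * b $ i $ j + a $ i $ j * b $ j $ j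
           + (\<Sum>p\<in>between E i j. a $ i $ p * b $ p $ j)"
proof -
  have z: "a $ i $ k * b $ k $ j = 0" if "k \<notin> {i, j} \<union> between E i j" for k
    using that coloured_space_zero[OF a, of i k] coloured_space_zero[OF b, of k j]
    by (auto simp: between_def)
  have "i \<notin> between E i j" "j \<notin> between E i j"
    using ordered_dag_less[OF E] by (auto simp: between_def)
  have "(a ** b) $ i $ j = (\<Sum>k\<in>UNIV. a $ i $ k * b $ k $ j)"
    by (simp add: matrix_matrix_mult_def)
  also have "\<dots> = (\<Sum>k\<in>insert i (insert j (between E i j)). a $ i $ k * b $ k $ j)"
    by (rule sum.mono_neutral_right) (use z in auto)
  finally show ?thesis
    using ne \<open>i \<notin> between E i j\<close> \<open>j \<notin> between E i j\<close> by simp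
qed

section \<open>Sufficiency of the two conditions\<close>

text \<open>The content of an isomorphism \<open>\<G>\<^bsub>b(ij)\<^esub> \<simeq> \<G>\<^bsub>b(kl)\<^esub>\<close>: if \<open>b(ij)\<close> is
  nonempty, it has to match the unique sinks \<open>i\<close>, \<open>k\<close> and the unique sources \<open>j\<close>, \<open>l\<close>. If \<open>b(ij)\<close>
  is empty, it may map \<open>i\<close> to \<open>l\<close>, but then \<open>c(i) = c(k)\<close> forces all four vertices to have the same
  colour.\<close>

lemma between_graph_isoD:
  fixes E :: "('v::{finite,linorder} \<times> 'v) set"
  assumes E: "ordered_dag E" and iso: "coloured_graph_iso (between_graph E c i j) (between_graph E c k l)"
    and ji: "(j, i) \<in> E" and lk: "(l, k) \<in> E" and col: "c i i = c k k"
  shows "c j j = c l l"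
    and "\<exists>f. bij_betw f (between E i j) (between E k l) \<and>
           (\<forall>p\<in>between E i j. c i p = c k (f p) \<and> c p j = c (f p) l)"
proof -
  let ?B = "between E i j" and ?B' = "between E k l"
  let ?V = "{i} \<union> {j} \<union> ?B" and ?V' = "{k} \<union> {l} \<union> ?B'"
  let ?D = "{(p, i) | p. p \<in> ?B} \<union> {(j, p) | p. p \<in> ?B}"
  let ?D' = "{(p, k) | p. p \<in> ?B'} \<union> {(l, p) | p. p \<in> ?B'}"
  obtain f where bij: "bij_betw f ?V ?V'"
    and edges: "\<forall>x\<in>?V. \<forall>y\<in>?V. (x, y) \<in> ?D \<longleftrightarrow> (f x, f y) \<in> ?D'"
    and vcols: "\<forall>x\<in>?V. c x x = c (f x) (f x)"
    and ecols: "\<forall>x y. (x, y) \<in> ?D \<longrightarrow> c y x = c (f y) (f x)"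
    using iso unfolding coloured_graph_iso_def between_graph_def coloured_graph.simps
    by (elim exE conjE)
  note edge = edges[rule_format] and vcol = bspec[OF vcols] and ecol = ecols[rule_format]
  have less: "\<And>x y. (x, y) \<in> E \<Longrightarrow> y < x" using ordered_dag_less[OF E] .
  have B: "i < p \<and> p < j" if "p \<in> ?B" for p using that less by (auto simp: between_def)
  have B': "k < p \<and> p < l" if "p \<in> ?B'" for p using that less by (auto simp: between_def)
  have inj: "inj_on f ?V" and im: "f ` ?V = ?V'" using bij by (auto simp: bij_betw_def)
  have key: "f p \<in> ?B' \<and> f j = l \<and> f i = k" if p: "p \<in> ?B" for p
  proof -
    have "(f j, f p) \<in> ?D'" "(f p, f i) \<in> ?D'"
      using edge[of j p] edge[of p i] p by auto
    then have "f p = k \<and> f j \<in> ?B' \<or> f j = l \<and> f p \<in> ?B'"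
      "f i = k \<and> f p \<in> ?B' \<or> f p = l \<and> f i \<in> ?B'" by auto
    moreover have "k \<notin> ?B'" "l \<notin> ?B'" "k \<noteq> l" using B' less[OF lk] by auto
    ultimately show ?thesis by auto
  qed
  have empty: "?B' = {}" if "?B = {}"
  proof (rule ccontr)
    assume "?B' \<noteq> {}"
    then obtain q where q: "q \<in> ?B'" by blast
    moreover have "l \<in> f ` ?V" "q \<in> f ` ?V" unfolding im using q by auto
    then obtain x y where "x \<in> ?V" "y \<in> ?V" "f x = l" "f y = q" by blast
    ultimately show False using edge[of x y] that by auto
  qed
  have img: "f ` ?B = ?B'"
  proof (cases "?B = {}")
    case True
    then show ?thesis using empty by simp
  next
    case False
    then have fj: "f j = l" and fi: "f i = k" using key by auto
    have "q \<in> f ` ?B" if q: "q \<in> ?B'" for q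
    proof -
      have "q \<in> f ` ?V" unfolding im using q by simp
      then show ?thesis using fi fj B'[OF q] by auto
    qed
    then show ?thesis using key by auto
  qed
  have "bij_betw f ?B ?B'"
    using img inj by (auto simp: bij_betw_def intro: inj_on_subset)
  moreover have "c i p = c k (f p) \<and> c p j = c (f p) l" if p: "p \<in> ?B" for p
    using ecol[of p i] ecol[of j p] key[OF p] p by auto
  ultimately show "\<exists>f. bij_betw f ?B ?B' \<and> (\<forall>p\<in>?B. c i p = c k (f p) \<and> c p j = c (f p) l)"
    by blast
  show "c j j = c l l"
  proof (cases "?B = {}")
    case True
    then have "f ` {i, j} = {k, l}" using im empty by (auto simp: insert_commute)
    then have "f i = k \<and> f j = l \<or> f i = l \<and> f j = k" by (auto simp: doubleton_eq_iff)
    then show ?thesis using vcol[of i] vcol[of j] col by auto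
  next
    case False
    then show ?thesis using key vcol[of j] by auto
  qed
qed

lemma coloured_space_mult:
  fixes E :: "('v::{finite,linorder} \<times> 'v) set"
  assumes E: "ordered_dag E" and c: "compatible E c" and tr: "trans E"
    and iso: "\<And>i j k l. (j, i) \<in> E \<Longrightarrow> (l, k) \<in> E \<Longrightarrow> c i j = c k l \<Longrightarrow>
        coloured_graph_iso (between_graph E c i j) (between_graph E c k l)"
    and a: "a \<in> coloured_space E c" and b: "b \<in> coloured_space E c"
  shows "a ** b \<in> coloured_space E c"
proof (rule coloured_spaceI[OF c])
  fix i j k l
  assume ji: "(j, i) \<in> E" and lk: "(l, k) \<in> E" and col: "c i j = c k l"
  have ii: "c i i = c k k" using compatible_target[OF c ji lk col] .
  have jj: "c j j = c l l" using between_graph_isoD(1)[OF E iso[OF ji lk col] ji lk ii] .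
  obtain f where f: "bij_betw f (between E i j) (between E k l)"
    and fc: "\<And>p. p \<in> between E i j \<Longrightarrow> c i p = c k (f p) \<and> c p j = c (f p) l"
    using between_graph_isoD(2)[OF E iso[OF ji lk col] ji lk ii] by blast
  have "a $ i $ p * b $ p $ j = a $ k $ f p * b $ f p $ l" if p: "p \<in> between E i j" for p
  proof -
    have "f p \<in> between E k l" using f p by (auto simp: bij_betw_def)
    then have "a $ i $ p = a $ k $ f p" "b $ p $ j = b $ f p $ l"
      using p fc[OF p] coloured_space_edge_eq[OF a, of p i "f p" k]
        coloured_space_edge_eq[OF b, of j p l "f p"] by (auto simp: between_def)
    then show ?thesis by simp
  qed
  then have "(\<Sum>p\<in>between E i j. a $ i $ p * b $ p $ j)
      = (\<Sum>p\<in>between E i j. a $ k $ f p * b $ f p $ l)"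
    by (rule sum.cong[OF refl])
  also have "\<dots> = (\<Sum>q\<in>between E k l. a $ k $ q * b $ q $ l)"
    by (rule sum.reindex_bij_betw[OF f])
  finally have "(\<Sum>p\<in>between E i j. a $ i $ p * b $ p $ j)
      = (\<Sum>q\<in>between E k l. a $ k $ q * b $ q $ l)" .
  moreover have "i \<noteq> j" "k \<noteq> l" using ordered_dag_less[OF E] ji lk by auto
  ultimately show "(a ** b) $ i $ j = (a ** b) $ k $ l"
    using product_at_edge[OF E a b, of i j] product_at_edge[OF E a b, of k l]
      coloured_space_vertex_eq[OF a ii] coloured_space_vertex_eq[OF b jj]
      coloured_space_edge_eq[OF a ji lk col] coloured_space_edge_eq[OF b ji lk col] by simp
next
  fix i k assume "c i i = c k k"
  then show "(a ** b) $ i $ i = (a ** b) $ k $ k"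
    using product_at_vertex[OF E a b] coloured_space_vertex_eq[OF a] coloured_space_vertex_eq[OF b]
    by metis
qed (rule product_zero[OF a b tr])

lemma coloured_space_one: "compatible E c \<Longrightarrow> ordered_dag E \<Longrightarrow> mat 1 \<in> coloured_space E c"
  by (rule coloured_spaceI) (auto simp: mat_def dest: ordered_dag_less)

text \<open>A finite-dimensional algebra of matrices contains the inverses of its invertible elements.\<close>

lemma subspace_matrix_inverse:
  fixes S :: "(real ^ 'n ^ 'n) set"
  assumes S: "subspace S" and one: "mat 1 \<in> S"
    and mult: "\<And>a b. a \<in> S \<Longrightarrow> b \<in> S \<Longrightarrow> a ** b \<in> S"
    and a: "a \<in> S" and inv: "invertible a"
  obtains x where "x \<in> S" "a ** x = mat 1" "x ** a = mat 1"
proof -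
  obtain a' where a': "a ** a' = mat 1" "a' ** a = mat 1" using inv by (auto simp: invertible_def)
  have lin: "linear ((**) a)"
    by (rule linearI) (simp_all add: matrix_add_ldistrib matrix_scalar_ac scalar_matrix_assoc)
  have "inj_on ((**) a) (span S)"
    by (rule inj_onI) (metis a'(2) matrix_mul_assoc matrix_mul_lid)
  then have "dim ((**) a ` S) = dim S" by (rule dim_image_eq[OF lin])
  moreover have "subspace ((**) a ` S)" using lin S by (rule linear_subspace_image)
  ultimately have "(**) a ` S = S"
    using subspace_dim_equal[of "(**) a ` S" S] S mult a by auto
  then obtain x where "x \<in> S" "a ** x = mat 1" using one by (metis imageE)
  then show ?thesis using that matrix_left_right_inverse by blast
qed

lemma group_coloured_matrices:
  fixes E :: "('v::{finite,linorder} \<times> 'v) set"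
  assumes E: "ordered_dag E" and c: "compatible E c" and tr: "trans E"
    and iso: "\<And>i j k l. (j, i) \<in> E \<Longrightarrow> (l, k) \<in> E \<Longrightarrow> c i j = c k l \<Longrightarrow>
        coloured_graph_iso (between_graph E c i j) (between_graph E c k l)"
  shows "group (coloured_matrix_group E c)"
proof (rule groupI)
  let ?G = "coloured_matrix_group E c"
  have mult: "a ** b \<in> coloured_space E c"
    if "a \<in> coloured_space E c" "b \<in> coloured_space E c" for a b
    using coloured_space_mult[OF E c tr] iso that by blast
  show "\<one>\<^bsub>?G\<^esub> \<in> carrier ?G"
    using coloured_space_one[OF c E]
    by (auto simp: coloured_matrix_group_def coloured_matrices_eq invertible_def)
  show "x \<otimes>\<^bsub>?G\<^esub> y \<in> carrier ?G" if "x \<in> carrier ?G" "y \<in> carrier ?G" for x y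
    using that mult by (auto simp: coloured_matrix_group_def coloured_matrices_eq invertible_mult)
  show "\<exists>y\<in>carrier ?G. y \<otimes>\<^bsub>?G\<^esub> x = \<one>\<^bsub>?G\<^esub>" if x: "x \<in> carrier ?G" for x
  proof -
    have "x \<in> coloured_space E c" "invertible x"
      using x by (auto simp: coloured_matrix_group_def coloured_matrices_eq)
    then obtain y where "y \<in> coloured_space E c" "x ** y = mat 1" "y ** x = mat 1"
      using subspace_matrix_inverse[OF subspace_coloured_space coloured_space_one[OF c E] mult]
      by blast
    then show ?thesis
      by (auto simp: coloured_matrix_group_def coloured_matrices_eq invertible_def)
  qed
qed (auto simp: coloured_matrix_group_def matrix_mul_assoc)

section \<open>Necessity of the two conditions\<close>

text \<open>The coloured matrix with prescribed values \<open>d\<close> on the vertex colours and \<open>e\<close> on the edge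
  colours.\<close>

definition colour_matrix ::
    "('v::finite \<times> 'v) set \<Rightarrow> ('v \<Rightarrow> 'v \<Rightarrow> 'c) \<Rightarrow> ('c \<Rightarrow> real) \<Rightarrow> ('c \<Rightarrow> real) \<Rightarrow> real ^ 'v ^ 'v" where
  "colour_matrix E c d e =
     (\<chi> i j. if i = j then d (c i i) else if (j, i) \<in> E then e (c i j) else 0)"

lemma colour_matrix_vertex: "colour_matrix E c d e $ i $ i = d (c i i)"
  by (simp add: colour_matrix_def)

lemma colour_matrix_edge:
  "ordered_dag E \<Longrightarrow> (j, i) \<in> E \<Longrightarrow> colour_matrix E c d e $ i $ j = e (c i j)"
  by (auto simp: colour_matrix_def dest: ordered_dag_less)

lemma colour_matrix_in_coloured_space:
  "ordered_dag E \<Longrightarrow> compatible E c \<Longrightarrow> colour_matrix E c d e \<in> coloured_space E c"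
  by (rule coloured_spaceI)
    (auto simp: colour_matrix_def dest: ordered_dag_less)

lemma colour_matrix_in_coloured_matrices:
  assumes "ordered_dag E" "compatible E c" "\<And>x. d x \<noteq> 0"
  shows "colour_matrix E c d e \<in> coloured_matrices E c"
  using assms colour_matrix_in_coloured_space[OF assms(1,2), of d e]
  by (simp add: coloured_matrices_eq invertible_if_diagonal_nonzero colour_matrix_vertex)

lemma trans_if_closed:
  fixes E :: "('v::{finite,linorder} \<times> 'v) set"
  assumes E: "ordered_dag E" and c: "compatible E c"
    and closed: "\<And>a b. a \<in> coloured_matrices E c \<Longrightarrow> b \<in> coloured_matrices E c
        \<Longrightarrow> a ** b \<in> coloured_matrices E c"
  shows "trans E"
proof (rule transI, rule ccontr)
  fix j p i assume jp: "(j, p) \<in> E" and pi: "(p, i) \<in> E" and ji: "(j, i) \<notin> E"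
  have ne: "i \<noteq> j" using ordered_dag_less[OF E] jp pi by (metis less_asym)
  define a where "a = colour_matrix E c (\<lambda>_. 1) (\<lambda>_. 1)"
  have nonneg: "0 \<le> a $ x $ y" for x y by (simp add: a_def colour_matrix_def)
  have "a \<in> coloured_matrices E c"
    unfolding a_def using E c by (rule colour_matrix_in_coloured_matrices) simp
  then have "a ** a \<in> coloured_matrices E c" using closed by blast
  then have "(a ** a) $ i $ j = 0" using ne ji by (simp add: coloured_matrices_def)
  moreover have "(a ** a) $ i $ j = (\<Sum>k\<in>UNIV. a $ i $ k * a $ k $ j)"
    by (simp add: matrix_matrix_mult_def)
  moreover have "a $ i $ p * a $ p $ j \<le> (\<Sum>k\<in>UNIV. a $ i $ k * a $ k $ j)"
    by (rule member_le_sum) (auto simp: nonneg)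
  moreover have "a $ i $ p * a $ p $ j = 1"
    unfolding a_def by (simp add: colour_matrix_edge[OF E] jp pi)
  ultimately show False by simp
qed

lemma bij_betw_if_fibres_equal_card:
  assumes fin: "finite A" "finite B"
    and card: "\<And>y. card {x \<in> A. g x = y} = card {x \<in> B. h x = y}"
  obtains f where "bij_betw f A B" "\<And>x. x \<in> A \<Longrightarrow> h (f x) = g x"
proof -
  have "\<exists>F. bij_betw F {x \<in> A. g x = y} {x \<in> B. h x = y}" for y
    by (rule finite_same_card_bij) (use fin card in auto)
  then obtain F where F: "\<And>y. bij_betw (F y) {x \<in> A. g x = y} {x \<in> B. h x = y}" by metis
  define f where "f x = F (g x) x" for x
  have mem: "f x \<in> B \<and> h (f x) = g x" if "x \<in> A" for x
    using bij_betw_apply[OF F[of "g x"], of x] that by (simp add: f_def)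
  have "inj_on f A"
  proof (rule inj_onI)
    fix x x' assume x: "x \<in> A" "x' \<in> A" and eq: "f x = f x'"
    then have "g x = g x'" using mem by metis
    then show "x = x'"
      using x eq F[of "g x"] by (auto simp: f_def bij_betw_def inj_on_def)
  qed
  moreover have "f ` A = B"
  proof (intro equalityI subsetI)
    fix z assume z: "z \<in> B"
    then have "z \<in> F (h z) ` {x \<in> A. g x = h z}"
      using F[of "h z"] by (auto simp: bij_betw_def)
    then obtain x where "x \<in> A" "g x = h z" "z = F (h z) x" by blast
    then have "z = f x" by (simp add: f_def)
    then show "z \<in> f ` A" using \<open>x \<in> A\<close> by blast
  qed (use mem in auto)
  ultimately show ?thesis using that mem by (auto simp: bij_betw_def)
qed

lemma between_graph_isoI:
  fixes E :: "('v::{finite,linorder} \<times> 'v) set"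
  assumes E: "ordered_dag E" and c: "compatible E c"
    and ji: "(j, i) \<in> E" and lk: "(l, k) \<in> E"
    and ii: "c i i = c k k" and jj: "c j j = c l l"
    and f: "bij_betw f (between E i j) (between E k l)"
    and fc: "\<And>p. p \<in> between E i j \<Longrightarrow> c i p = c k (f p) \<and> c p j = c (f p) l"
  shows "coloured_graph_iso (between_graph E c i j) (between_graph E c k l)"
proof -
  let ?B = "between E i j" and ?B' = "between E k l"
  define g where "g x = (if x = i then k else if x = j then l else f x)" for x
  have less: "\<And>x y. (x, y) \<in> E \<Longrightarrow> y < x" using ordered_dag_less[OF E] .
  have B: "i < p \<and> p < j" if "p \<in> ?B" for p using that less by (auto simp: between_def)
  have B': "k < p \<and> p < l" if "p \<in> ?B'" for p using that less by (auto simp: between_def)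
  have gi: "g i = k" and gj: "g j = l" using less[OF ji] by (auto simp: g_def)
  have gp: "g p = f p" if "p \<in> ?B" for p using B[OF that] by (auto simp: g_def)
  have fB: "f p \<in> ?B'" if "p \<in> ?B" for p using bij_betw_apply[OF f that] .
  have g_bij: "bij_betw g ?B ?B'" using f gp by (simp cong: bij_betw_cong)
  have "bij_betw g ({i, j} \<union> ?B) ({k, l} \<union> ?B')"
  proof (rule bij_betw_combine[OF _ g_bij])
    show "bij_betw g {i, j} {k, l}"
      using gi gj less[OF lk] by (auto simp: bij_betw_def inj_on_def)
    show "{k, l} \<inter> ?B' = {}" using B' by auto
  qed
  then have bij: "bij_betw g ({i} \<union> {j} \<union> ?B) ({k} \<union> {l} \<union> ?B')"
    by (simp only: insert_is_Un[of i "{j}"] insert_is_Un[of k "{l}"])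
  have vcol: "c p p = c (f p) (f p)" if p: "p \<in> ?B" for p
    using compatible_target[OF c, of j p l "f p"] fc[OF p] p fB[OF p] by (auto simp: between_def)
  have mem: "g x \<in> ?B' \<longleftrightarrow> x \<in> ?B" "g x = k \<longleftrightarrow> x = i" "g x = l \<longleftrightarrow> x = j"
    if "x \<in> {i} \<union> {j} \<union> ?B" for x
  proof -
    have "i \<notin> ?B" "j \<notin> ?B" "k \<notin> ?B'" "l \<notin> ?B'" "i \<noteq> j" "k \<noteq> l"
      using B B' less[OF ji] less[OF lk] by auto
    moreover from that consider "x = i" | "x = j" | "x \<in> ?B" by blast
    then have "x = i \<and> g x = k \<or> x = j \<and> g x = l \<or> x \<in> ?B \<and> g x \<in> ?B'"
      using gi gj gp fB by cases auto
    ultimately show "g x \<in> ?B' \<longleftrightarrow> x \<in> ?B" "g x = k \<longleftrightarrow> x = i" "g x = l \<longleftrightarrow> x = j" by auto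
  qed
  show ?thesis
    unfolding coloured_graph_iso_def between_graph_def
  proof (simp only: coloured_graph.simps, intro exI[of _ g] conjI ballI allI impI)
    fix x y assume "x \<in> {i} \<union> {j} \<union> ?B" "y \<in> {i} \<union> {j} \<union> ?B"
    then show "(x, y) \<in> {(k, i) | k. k \<in> ?B} \<union> {(j, k) | k. k \<in> ?B} \<longleftrightarrow>
        (g x, g y) \<in> {(q, k) | q. q \<in> ?B'} \<union> {(l, q) | q. q \<in> ?B'}"
      using mem by auto
  next
    fix x assume "x \<in> {i} \<union> {j} \<union> ?B"
    then show "c x x = c (g x) (g x)" using gi gj gp ii jj vcol by auto
  next
    fix x y assume "(x, y) \<in> {(k, i) | k. k \<in> ?B} \<union> {(j, k) | k. k \<in> ?B}"
    then show "c y x = c (g y) (g x)" using gi gj gp fc by auto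
  qed (rule bij)
qed

lemma between_graph_iso_if_closed:
  fixes E :: "('v::{finite,linorder} \<times> 'v) set" and c :: "'v \<Rightarrow> 'v \<Rightarrow> 'c"
  assumes E: "ordered_dag E" and c: "compatible E c"
    and closed: "\<And>a b. a \<in> coloured_matrices E c \<Longrightarrow> b \<in> coloured_matrices E c
        \<Longrightarrow> a ** b \<in> coloured_matrices E c"
    and ji: "(j, i) \<in> E" and lk: "(l, k) \<in> E" and col: "c i j = c k l"
  shows "coloured_graph_iso (between_graph E c i j) (between_graph E c k l)"
proof -
  have ne: "i \<noteq> j" "k \<noteq> l" using ordered_dag_less[OF E] ji lk by auto
  have ii: "c i i = c k k" using compatible_target[OF c ji lk col] .
  have eq: "d (c i i) * e' (c i j) + e (c i j) * d' (c j j)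
        + (\<Sum>p\<in>between E i j. e (c i p) * e' (c p j))
      = d (c k k) * e' (c k l) + e (c k l) * d' (c l l)
        + (\<Sum>q\<in>between E k l. e (c k q) * e' (c q l))"
    if "\<And>x. d x \<noteq> 0" "\<And>x. d' x \<noteq> 0" for d d' e e' :: "'c \<Rightarrow> real"
  proof -
    let ?a = "colour_matrix E c d e" and ?b = "colour_matrix E c d' e'"
    have "?a ** ?b \<in> coloured_matrices E c"
      using closed colour_matrix_in_coloured_matrices[OF E c] that by blast
    then have *: "(?a ** ?b) $ i $ j = (?a ** ?b) $ k $ l"
      using coloured_space_edge_eq[OF _ ji lk col] by (simp add: coloured_matrices_eq)
    have entry: "(?a ** ?b) $ x $ y = d (c x x) * e' (c x y) + e (c x y) * d' (c y y)
        + (\<Sum>p\<in>between E x y. e (c x p) * e' (c p y))" if "(y, x) \<in> E" for x y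
    proof -
      have "(\<Sum>p\<in>between E x y. ?a $ x $ p * ?b $ p $ y)
          = (\<Sum>p\<in>between E x y. e (c x p) * e' (c p y))"
        by (rule sum.cong) (auto simp: between_def colour_matrix_edge[OF E])
      moreover have "x \<noteq> y" using ordered_dag_less[OF E that] by simp
      ultimately show ?thesis
        using product_at_edge[OF E colour_matrix_in_coloured_space[OF E c]
            colour_matrix_in_coloured_space[OF E c], of x y d e d' e']
        by (simp add: colour_matrix_vertex colour_matrix_edge[OF E that])
    qed
    show ?thesis using * entry[OF ji] entry[OF lk] by simp
  qed
  \<comment> \<open>A diagonal second factor kills the sums over \<open>b(ij)\<close> and \<open>b(kl)\<close> and picks out the source
    vertex.\<close>
  have jj: "c j j = c l l"
  proof -
    define d' :: "'c \<Rightarrow> real" where "d' x = (if x = c j j then 1 else 2)" for x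
    have "d' (c j j) = d' (c l l)"
      using eq[where d = "\<lambda>_. 1" and d' = d' and e = "\<lambda>_. 1" and e' = "\<lambda>_. 0"]
      by (simp add: d'_def)
    then show ?thesis by (simp add: d'_def split: if_splits)
  qed
  \<comment> \<open>Unit diagonals and indicators of two edge colours turn the identity into an equality of
    cardinalities.\<close>
  have count: "card {p \<in> between E i j. (c i p, c p j) = y} = card {q \<in> between E k l. (c k q, c q l) = y}"
    for y
  proof -
    obtain \<alpha> \<beta> where y: "y = (\<alpha>, \<beta>)" by (cases y)
    have sum: "(\<Sum>p\<in>B. of_bool (u p = \<alpha>) * of_bool (v p = \<beta>)) = real (card {p \<in> B. (u p, v p) = y})"
      if "finite B" for B :: "'v set" and u v :: "'v \<Rightarrow> 'c"
      using that by (simp add: y flip: of_bool_conj) (simp add: of_bool_def sum.If_cases Int_def)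
    show ?thesis
      using eq[where d = "\<lambda>_. 1" and d' = "\<lambda>_. 1"
          and e = "\<lambda>x. of_bool (x = \<alpha>)" and e' = "\<lambda>x. of_bool (x = \<beta>)"]
      unfolding sum[OF finite] by (simp add: col)
  qed
  obtain f where "bij_betw f (between E i j) (between E k l)"
    "\<And>p. p \<in> between E i j \<Longrightarrow> (c k (f p), c (f p) l) = (c i p, c p j)"
    using bij_betw_if_fibres_equal_card[OF finite finite count] by blast
  then show ?thesis
    using between_graph_isoI[OF E c ji lk ii jj] by simp
qed

theorem propositionB2:
  fixes E :: "('v::{finite,linorder} \<times> 'v) set"
    and c :: "'v \<Rightarrow> 'v \<Rightarrow> 'c"
  assumes "ordered_dag E"
    and "compatible E c"
  shows "group (coloured_matrix_group E c) \<longleftrightarrow>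
           trans E \<and>
           (\<forall>i j k l. (j, i) \<in> E \<longrightarrow> (l, k) \<in> E \<longrightarrow> c i j = c k l \<longrightarrow>
              coloured_graph_iso (between_graph E c i j) (between_graph E c k l))"
proof
  assume "group (coloured_matrix_group E c)"
  then interpret group "coloured_matrix_group E c" .
  have "a ** b \<in> coloured_matrices E c"
    if "a \<in> coloured_matrices E c" "b \<in> coloured_matrices E c" for a b
    using m_closed[of a b] that by (simp add: coloured_matrix_group_def)
  then show "trans E \<and>
      (\<forall>i j k l. (j, i) \<in> E \<longrightarrow> (l, k) \<in> E \<longrightarrow> c i j = c k l \<longrightarrow>
        coloured_graph_iso (between_graph E c i j) (between_graph E c k l))"
    using trans_if_closed[OF assms] between_graph_iso_if_closed[OF assms] by blast
next
  assume "trans E \<and>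
      (\<forall>i j k l. (j, i) \<in> E \<longrightarrow> (l, k) \<in> E \<longrightarrow> c i j = c k l \<longrightarrow>
        coloured_graph_iso (between_graph E c i j) (between_graph E c k l))"
  then show "group (coloured_matrix_group E c)"
    using group_coloured_matrices[OF assms] by blast
qed

end
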